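(* Let $H$ be a real Hilbert space and let $F=f+g$, where $f:H\to\mathbb{R}$ is $\mu$-strongly convex and $L$-smooth with $L\ge\mu>0$, and $g:H\to\mathbb{R}\cup\{\infty\}$ is convex, proper and lower-semicontinuous. Assume $\operatorname{argmin}(F)\neq\emptyset$, let $x^*\in\operatorname{argmin}(F)$ and $F^*=F(x^* )$. Let $(x_k),(y_k)$ be generated by (G-APM) with $s=\frac1L$ and $\gamma=\frac23$ from initial points $x_0,y_0\in H$. Then for every $k\ge2$, $$F(y_k)-F^*\le\frac{3L\|x_0-x^*\|^2}{4t_k(t_k-1)}(1+\rho)^{-k+2},\quad\text{with}\quad\rho=\frac{\mu}{3L+5\mu}.$$
   Context: $L$-smooth means $f$ is differentiable with $L$-Lipschitz gradient. $\mu$-strongly convex means $f-\frac{\mu}{2}\|\cdot\|^2$ is convex. $\operatorname{prox}_{sg}(v)=\operatorname{arg\,min}_{u\in H}\{g(u)+\frac{1}{2s}\|u-v\|^2\}$. The sequence $(t_k)_{k\ge0}$ is $t_0=1$, $t_k=\frac{1+\sqrt{1+4t_{k-1}^2}}{2}$ for $k\ge1$. Algorithm (G-APM) with parameters $s,\gamma$: given $x_0,y_0\in H$, for $k\ge0$, $$y_{k+1}=\operatorname{prox}_{sg}(x_k-s\nabla f(x_k)),$$ $$x_{k+1}=y_{k+1}+\frac{t_k-1}{t_{k+1}}(y_{k+1}-y_k)+\frac{t_k}{t_{k+1}}(\gamma-1)(y_{k+1}-x_k).$$ *)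

theory Defs
  imports "HOL-Analysis.Analysis"
begin

(* The description is well defined: at most one D satisfies GDERIV f x :> D, and in a Hilbert
   space such a D exists whenever f is differentiable at x (Riesz). *)
definition gradient :: "('a::real_inner \<Rightarrow> real) \<Rightarrow> 'a \<Rightarrow> 'a" where
  "gradient f x = (THE D. GDERIV f x :> D)"

definition smooth_with :: "real \<Rightarrow> ('a::real_inner \<Rightarrow> real) \<Rightarrow> bool" where
  "smooth_with L f \<longleftrightarrow> (\<forall>x. f differentiable (at x)) \<and> L-lipschitz_on UNIV (gradient f)"

definition strongly_convex :: "real \<Rightarrow> ('a::real_inner \<Rightarrow> real) \<Rightarrow> bool" where
  "strongly_convex \<mu> f \<longleftrightarrow> convex_on UNIV (\<lambda>x. f x - \<mu> / 2 * (norm x)\<^sup>2)"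

(* The value - \<infinity> is excluded by proper_ereal; note 0 * \<infinity> = 0 in ereal, so the cases
   u = 0 and v = 0 are harmless. *)
definition convex_ereal :: "('a::real_vector \<Rightarrow> ereal) \<Rightarrow> bool" where
  "convex_ereal g \<longleftrightarrow> (\<forall>x y. \<forall>u\<ge>0. \<forall>v\<ge>0. u + v = 1 \<longrightarrow>
     g (u *\<^sub>R x + v *\<^sub>R y) \<le> ereal u * g x + ereal v * g y)"

definition proper_ereal :: "('a \<Rightarrow> ereal) \<Rightarrow> bool" where
  "proper_ereal g \<longleftrightarrow> (\<forall>x. g x \<noteq> - \<infinity>) \<and> (\<exists>x. g x \<noteq> \<infinity>)"

definition lower_semicontinuous :: "('a::topological_space \<Rightarrow> ereal) \<Rightarrow> bool" where
  "lower_semicontinuous g \<longleftrightarrow> (\<forall>x. g x \<le> Liminf (at x) g)"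

(* The choice in arg_min is immaterial for proper, convex, lower semicontinuous g and s > 0
   on a Hilbert space, where the minimizer exists and is unique. *)
definition prox :: "real \<Rightarrow> ('a::real_inner \<Rightarrow> ereal) \<Rightarrow> 'a \<Rightarrow> 'a" where
  "prox s g v = arg_min (\<lambda>u. g u + ereal (1 / (2 * s) * (norm (u - v))\<^sup>2)) (\<lambda>_. True)"

primrec t_seq :: "nat \<Rightarrow> real" where
  "t_seq 0 = 1"
| "t_seq (Suc k) = (1 + sqrt (1 + 4 * (t_seq k)\<^sup>2)) / 2"

definition gapm :: "('a::real_inner \<Rightarrow> real) \<Rightarrow> ('a \<Rightarrow> ereal) \<Rightarrow> real \<Rightarrow> real \<Rightarrow>
    (nat \<Rightarrow> 'a) \<Rightarrow> (nat \<Rightarrow> 'a) \<Rightarrow> bool" where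
  "gapm f g s \<gamma> x y \<longleftrightarrow> (\<forall>k.
     y (Suc k) = prox s g (x k - s *\<^sub>R gradient f (x k)) \<and>
     x (Suc k) = y (Suc k)
       + ((t_seq k - 1) / t_seq (Suc k)) *\<^sub>R (y (Suc k) - y k)
       + (t_seq k / t_seq (Suc k) * (\<gamma> - 1)) *\<^sub>R (y (Suc k) - x k))"

end

theory Submission
  imports Defs
begin

text \<open>
  Put \<open>d\<^sub>k = x\<^sub>k - y\<^sub>k\<^sub>+\<^sub>1\<close> and \<open>z\<^sub>k = y\<^sub>k + t\<^sub>k (x\<^sub>k - y\<^sub>k)\<close>, so that
  \<open>z\<^sub>k\<^sub>+\<^sub>1 = z\<^sub>k - \<gamma> t\<^sub>k d\<^sub>k\<close>, and consider the energy
  \<open>E\<^sub>k = t\<^sub>k (t\<^sub>k - 1) (F(y\<^sub>k) - F(x\<^sup>*)) + L / (2\<gamma>) \<parallel>z\<^sub>k - x\<^sup>*\<parallel>\<^sup>2\<close>.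
  Because \<open>\<gamma> < 1\<close>, the usual FISTA estimate leaves the surplus
  \<open>(1 - \<gamma>) L / 2 t\<^sub>k\<^sup>2 \<parallel>d\<^sub>k\<parallel>\<^sup>2\<close> in \<open>E\<^sub>k - E\<^sub>k\<^sub>+\<^sub>1\<close>, which strong convexity turns into a
  multiple of \<open>t\<^sub>k\<^sup>2 (F(y\<^sub>k\<^sub>+\<^sub>1) - F(x\<^sup>*))\<close>; the quadratic terms of strong convexity
  contribute \<open>\<mu> / 2 \<parallel>z\<^sub>k - x\<^sup>*\<parallel>\<^sup>2\<close> by Jensen's inequality. Together they give
  \<open>(1 + \<rho>) E\<^sub>k\<^sub>+\<^sub>1 \<le> E\<^sub>k\<close> for every \<open>k\<close>.
\<close>

section \<open>First-order conditions and existence of proximal points\<close>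

text \<open>Divide by \<open>t\<close> and let \<open>t\<close> tend to 0 from the right. This
  extracts a first-order condition from a comparison along a segment.\<close>

lemma nonneg_first_order:
  fixes a b :: real
  assumes "\<And>t. 0 < t \<Longrightarrow> t \<le> 1 \<Longrightarrow> 0 \<le> t * a + t\<^sup>2 * b"
  shows "0 \<le> a"
proof (rule tendsto_lowerbound)
  show "((\<lambda>t. a + t * b) \<longlongrightarrow> a) (at_right 0)"
    by (auto intro!: tendsto_eq_intros)
  have "0 \<le> a + t * b" if "0 < t" "t < 1" for t
  proof -
    have "0 \<le> t * (a + t * b)"
      using assms[of t] that by (simp add: algebra_simps power2_eq_square)
    then show ?thesis
      using that by (simp add: zero_le_mult_iff)
  qed
  then show "\<forall>\<^sub>F t in at_right 0. 0 \<le> a + t * b"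
    using eventually_at_right_real[of 0 1] by (auto elim: eventually_mono)
qed simp

lemma convex_ereal_segment:
  assumes "convex_ereal g" "g x = ereal a" "g y = ereal b" "0 \<le> t" "t \<le> 1"
  shows "g (x + t *\<^sub>R (y - x)) \<le> ereal ((1 - t) * a + t * b)"
proof -
  have "g ((1 - t) *\<^sub>R x + t *\<^sub>R y) \<le> ereal (1 - t) * g x + ereal t * g y"
    using assms(1)[unfolded convex_ereal_def, rule_format, of "1 - t" t x y] assms(4,5) by simp
  moreover have "(1 - t) *\<^sub>R x + t *\<^sub>R y = x + t *\<^sub>R (y - x)"
    by (simp add: algebra_simps)
  ultimately show ?thesis
    using assms by simp
qed

lemma norm_midpoint_sq:
  fixes a b :: "'a::real_inner"
  shows "(norm ((1 / 2) *\<^sub>R (a + b)))\<^sup>2 = (norm a)\<^sup>2 / 2 + (norm b)\<^sup>2 / 2 - (norm (a - b))\<^sup>2 / 4"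
  unfolding power2_norm_eq_inner by (simp add: inner_simps inner_commute field_simps)

text \<open>By the parallelogram law a minimizing sequence is Cauchy.\<close>

lemma ex_prox_minimizer:
  fixes g :: "'a::{real_inner, complete_space} \<Rightarrow> ereal"
  assumes cvx: "convex_ereal g" and proper: "proper_ereal g" and lsc: "lower_semicontinuous g"
    and q: "0 < q" and lb: "\<And>u. ereal B \<le> g u + ereal (q * (norm (u - v))\<^sup>2)"
  shows "\<exists>p. is_arg_min (\<lambda>u. g u + ereal (q * (norm (u - v))\<^sup>2)) (\<lambda>_. True) p"
proof -
  \<comment> \<open>Only finite values of \<open>g\<close> enter \<open>S\<close>, so its infimum is
    taken in the reals.\<close>
  define S where "S = {c + q * (norm (u - v))\<^sup>2 |u c. g u = ereal c}"
  define I where "I = Inf S"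
  have fin: "g u = ereal (real_of_ereal (g u))" if "g u \<noteq> \<infinity>" for u
    using that proper by (cases "g u") (auto simp: proper_ereal_def)
  have S_bdd: "bdd_below S"
  proof (rule bdd_belowI[of _ B])
    fix r assume "r \<in> S"
    then obtain u c where "g u = ereal c" "r = c + q * (norm (u - v))\<^sup>2"
      unfolding S_def by blast
    then show "B \<le> r" using lb[of u] by simp
  qed
  have S_ne: "S \<noteq> {}"
    using proper fin unfolding S_def proper_ereal_def by blast
  have I_le: "I \<le> c + q * (norm (u - v))\<^sup>2" if "g u = ereal c" for u c
    unfolding I_def by (rule cInf_lower[OF _ S_bdd]) (use that in \<open>auto simp: S_def\<close>)
  have "\<exists>u c. g u = ereal c \<and> c + q * (norm (u - v))\<^sup>2 < I + inverse (real (Suc n))" for n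
    using cInf_lessD[OF S_ne, of "I + inverse (real (Suc n))"] unfolding I_def[symmetric]
    by (auto simp: S_def)
  then obtain u c where gu: "\<And>n. g (u n) = ereal (c n)"
    and near: "\<And>n. c n + q * (norm (u n - v))\<^sup>2 < I + inverse (real (Suc n))"
    by metis
  \<comment> \<open>The value at the midpoint is at least \<open>I\<close>, yet it lies at least
    \<open>q / 4 * (norm (u m - u n))\<^sup>2\<close> below the average of two nearly minimal
    values.\<close>
  have dist_bound: "q / 4 * (norm (u m - u n))\<^sup>2
      < inverse (real (Suc m)) / 2 + inverse (real (Suc n)) / 2" for m n
  proof -
    define p where "p = u m + (1 / 2 :: real) *\<^sub>R (u n - u m)"
    have gp: "g p \<le> ereal (c m / 2 + c n / 2)"
      using convex_ereal_segment[OF cvx gu gu, of "1 / 2" m n] unfolding p_def by simp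
    then have "g p = ereal (real_of_ereal (g p))"
      by (intro fin) auto
    then obtain r where r: "g p = ereal r" by blast
    have pv: "p - v = (1 / 2) *\<^sub>R ((u m - v) + (u n - v))"
    proof -
      have "v = (1 / 2 :: real) *\<^sub>R v + (1 / 2 :: real) *\<^sub>R v"
        by (simp flip: scaleR_add_left)
      moreover have "u m = (1 / 2 :: real) *\<^sub>R u m + (1 / 2 :: real) *\<^sub>R u m"
        by (simp flip: scaleR_add_left)
      ultimately show ?thesis
        unfolding p_def by (simp add: algebra_simps)
    qed
    have "(norm (p - v))\<^sup>2
        = (norm (u m - v))\<^sup>2 / 2 + (norm (u n - v))\<^sup>2 / 2 - (norm (u m - u n))\<^sup>2 / 4"
      unfolding pv norm_midpoint_sq by simp
    from arg_cong[OF this, of "(*) q"] have "q * (norm (p - v))\<^sup>2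
        = q * (norm (u m - v))\<^sup>2 / 2 + q * (norm (u n - v))\<^sup>2 / 2 - q / 4 * (norm (u m - u n))\<^sup>2"
      by (simp add: algebra_simps)
    moreover have "I \<le> c m / 2 + c n / 2 + q * (norm (p - v))\<^sup>2"
      using I_le[OF r] gp r by simp
    ultimately show ?thesis
      using near[of m] near[of n] by argo
  qed
  have "Cauchy u"
  proof (rule metric_CauchyI)
    fix e :: real assume "0 < e"
    then have "0 < q / 4 * e\<^sup>2" using q by simp
    then obtain M where M: "inverse (real (Suc M)) < q / 4 * e\<^sup>2"
      using reals_Archimedean by blast
    have "dist (u m) (u n) < e" if "M \<le> m" "M \<le> n" for m n
    proof -
      have "inverse (real (Suc m)) \<le> inverse (real (Suc M))"
        "inverse (real (Suc n)) \<le> inverse (real (Suc M))"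
        using that by (auto intro!: le_imp_inverse_le)
      then have "q / 4 * (norm (u m - u n))\<^sup>2 < q / 4 * e\<^sup>2"
        using dist_bound[of m n] M by linarith
      then have "(norm (u m - u n))\<^sup>2 < e\<^sup>2" using q by simp
      then show ?thesis
        using \<open>0 < e\<close> by (simp add: dist_norm power2_less_imp_less)
    qed
    then show "\<exists>M. \<forall>m\<ge>M. \<forall>n\<ge>M. dist (u m) (u n) < e" by blast
  qed
  then obtain p where lim: "u \<longlonglongrightarrow> p"
    by (meson Cauchy_convergent convergent_def)
  \<comment> \<open>Lower semicontinuity is tested on bounds \<open>C\<close> below
    \<open>g p\<close>, so that \<open>g p\<close> need not be known to be finite
    beforehand.\<close>
  have "C \<le> ereal (I - q * (norm (p - v))\<^sup>2)" if "C < g p" for C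
  proof (cases C)
    case (real r)
    have "\<forall>\<^sub>F z in at p. C < g z"
      using lsc that unfolding lower_semicontinuous_def by (auto simp: le_Liminf_iff)
    \<comment> \<open>\<open>Liminf (at p)\<close> ignores the point \<open>p\<close> itself, which
      the sequence may hit; \<open>that\<close> covers it.\<close>
    then have "\<forall>\<^sub>F z in nhds p. C < g z"
      using that by (simp add: eventually_nhds_conv_at)
    then have "\<forall>\<^sub>F n in sequentially. C < g (u n)"
      using lim filterlim_iff by blast
    then have ev: "\<forall>\<^sub>F n in sequentially.
        r + q * (norm (u n - v))\<^sup>2 \<le> I + inverse (real (Suc n))"
    proof (rule eventually_mono)
      fix n assume "C < g (u n)"
      then show "r + q * (norm (u n - v))\<^sup>2 \<le> I + inverse (real (Suc n))"
        using near[of n] real gu[of n] by simp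
    qed
    have "(\<lambda>n. I + inverse (real (Suc n))) \<longlonglongrightarrow> I + 0"
      by (intro tendsto_intros LIMSEQ_inverse_real_of_nat)
    moreover have "(\<lambda>n. r + q * (norm (u n - v))\<^sup>2) \<longlonglongrightarrow> r + q * (norm (p - v))\<^sup>2"
      by (intro tendsto_intros lim)
    ultimately have "r + q * (norm (p - v))\<^sup>2 \<le> I + 0"
      using tendsto_le[OF sequentially_bot _ _ ev] by blast
    then show ?thesis using real by simp
  qed (use that in auto)
  then have gp: "g p \<le> ereal (I - q * (norm (p - v))\<^sup>2)"
    by (rule dense_le)
  then have "g p + ereal (q * (norm (p - v))\<^sup>2) \<le> ereal I"
    using fin[of p] by (cases "g p") auto
  moreover have "ereal I \<le> g z + ereal (q * (norm (z - v))\<^sup>2)" for z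
    using I_le[of z] proper by (cases "g z") (auto simp: proper_ereal_def)
  ultimately show ?thesis
    unfolding is_arg_min_linorder by (meson order_trans)
qed

text \<open>Compare \<open>p\<close> with \<open>p + t *\<^sub>R (u - p)\<close> and keep the terms
  linear in \<open>t\<close>: the vector \<open>2 * q *\<^sub>R (v - p)\<close> is a subgradient of
  \<open>g\<close> at \<open>p\<close>.\<close>

lemma prox_variational_ineq:
  fixes g :: "'a::real_inner \<Rightarrow> ereal"
  assumes cvx: "convex_ereal g" and proper: "proper_ereal g"
    and min: "is_arg_min (\<lambda>u. g u + ereal (q * (norm (u - v))\<^sup>2)) (\<lambda>_. True) p"
  obtains a where "g p = ereal a"
    and "\<And>u b. g u = ereal b \<Longrightarrow> a + 2 * q * ((v - p) \<bullet> (u - p)) \<le> b"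
proof -
  have le: "g p + ereal (q * (norm (p - v))\<^sup>2) \<le> g z + ereal (q * (norm (z - v))\<^sup>2)" for z
    using min unfolding is_arg_min_linorder by simp
  obtain z0 where "g z0 \<noteq> \<infinity>" using proper unfolding proper_ereal_def by blast
  then have "g p \<noteq> \<infinity>" using le[of z0] by auto
  then obtain a where a: "g p = ereal a"
    using proper unfolding proper_ereal_def by (cases "g p") auto
  have "a + 2 * q * ((v - p) \<bullet> (u - p)) \<le> b" if b: "g u = ereal b" for u b
  proof -
    have "0 \<le> t * (b - a - 2 * q * ((v - p) \<bullet> (u - p))) + t\<^sup>2 * (q * (norm (u - p))\<^sup>2)"
      if t: "0 < t" "t \<le> 1" for t
    proof -
      define z where "z = p + t *\<^sub>R (u - p)"
      have gz: "g z \<le> ereal ((1 - t) * a + t * b)"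
        unfolding z_def using convex_ereal_segment[OF cvx a b] t by simp
      have "ereal (a + q * (norm (p - v))\<^sup>2) \<le> g z + ereal (q * (norm (z - v))\<^sup>2)"
        using le[of z] a by simp
      also have "\<dots> \<le> ereal ((1 - t) * a + t * b) + ereal (q * (norm (z - v))\<^sup>2)"
        by (intro add_right_mono gz)
      finally have "a + q * (norm (p - v))\<^sup>2 \<le> (1 - t) * a + t * b + q * (norm (z - v))\<^sup>2"
        by simp
      moreover have "(norm (z - v))\<^sup>2
          = (norm (p - v))\<^sup>2 - 2 * t * ((v - p) \<bullet> (u - p)) + t\<^sup>2 * (norm (u - p))\<^sup>2"
        unfolding z_def power2_norm_eq_inner
        by (simp add: inner_simps inner_commute algebra_simps power2_eq_square)
      ultimately show ?thesis by (simp add: algebra_simps)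
    qed
    from nonneg_first_order[OF this] show ?thesis by simp
  qed
  with a show ?thesis using that by blast
qed

section \<open>Gradients in Hilbert space\<close>

text \<open>The representing vector is the minimizer of \<open>\<parallel>u\<parallel>\<^sup>2 / 2 - \<phi> u\<close>.\<close>

lemma riesz_representation:
  fixes \<phi> :: "'a::{real_inner, complete_space} \<Rightarrow> real"
  assumes "bounded_linear \<phi>"
  obtains D where "\<And>h. \<phi> h = h \<bullet> D"
proof -
  interpret bounded_linear \<phi> by fact
  let ?g = "\<lambda>u. ereal (- \<phi> u)"
  obtain K where K: "\<And>u. norm (\<phi> u) \<le> norm u * K" using bounded by blast
  have cvx: "convex_ereal ?g" unfolding convex_ereal_def by (simp add: add scaleR)
  have proper: "proper_ereal ?g" unfolding proper_ereal_def by simp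
  have lsc: "lower_semicontinuous ?g"
    unfolding lower_semicontinuous_def
  proof
    fix x
    have lim: "(?g \<longlongrightarrow> ?g x) (at x)"
      by (intro tendsto_intros tendsto)
    show "?g x \<le> Liminf (at x) ?g"
      unfolding le_Liminf_iff using order_tendstoD(1)[OF lim] by blast
  qed
  \<comment> \<open>With the operator bound \<open>K\<close>, completing the square in
    \<open>norm u\<close> bounds the objective below.\<close>
  have "ereal (- K\<^sup>2 / 2) \<le> ?g u + ereal (1 / 2 * (norm (u - 0))\<^sup>2)" for u
  proof -
    have "0 \<le> (norm u - K)\<^sup>2" by simp
    then show ?thesis
      using K[of u] by (simp add: power2_diff algebra_simps)
  qed
  from ex_prox_minimizer[OF cvx proper lsc _ this]
  obtain D where "is_arg_min (\<lambda>u. ?g u + ereal (1 / 2 * (norm (u - 0))\<^sup>2)) (\<lambda>_. True) D"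
    by auto
  from prox_variational_ineq[OF cvx proper this] obtain a where a: "ereal (- \<phi> D) = ereal a"
    and ineq: "\<And>u b. ereal (- \<phi> u) = ereal b \<Longrightarrow> a + 2 * (1 / 2) * ((0 - D) \<bullet> (u - D)) \<le> b"
    by blast
  have "\<phi> h \<le> h \<bullet> D" for h
    using ineq[of "D + h" "- \<phi> (D + h)"] a by (simp add: add inner_commute)
  from this[of h for h] this[of "- h" for h] have "\<phi> h = h \<bullet> D" for h
    by (simp add: linear_neg[OF linear_axioms] order_antisym)
  then show ?thesis using that by blast
qed

text \<open>Justifies the \<open>THE\<close> in \<open>gradient\<close>: Riesz representation of the
  derivative gives existence, uniqueness of derivatives gives uniqueness.\<close>

lemma GDERIV_gradient:
  fixes f :: "'a::{real_inner, complete_space} \<Rightarrow> real"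
  assumes "f differentiable (at x)"
  shows "GDERIV f x :> gradient f x"
proof -
  obtain f' where f': "(f has_derivative f') (at x)"
    using assms unfolding differentiable_def by blast
  obtain D where "\<And>h. f' h = h \<bullet> D"
    using riesz_representation[OF has_derivative_bounded_linear[OF f']] by blast
  then have "f' = (\<lambda>h. h \<bullet> D)" by auto
  with f' have D: "GDERIV f x :> D" unfolding gderiv_def by simp
  have "E = D" if "GDERIV f x :> E" for E
  proof -
    have "(\<lambda>h. h \<bullet> E) = (\<lambda>h. h \<bullet> D)"
      using that D unfolding gderiv_def by (rule has_derivative_unique)
    then have "(E - D) \<bullet> E = (E - D) \<bullet> D" by metis
    then have "(E - D) \<bullet> (E - D) = 0" by (simp add: inner_diff_right)
    then show ?thesis by simp
  qed
  with D show ?thesis unfolding gradient_def by (rule theI)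
qed

section \<open>Smoothness, strong convexity and the proximal gradient step\<close>

lemma descent_lemma:
  fixes f :: "'a::real_inner \<Rightarrow> real"
  assumes D: "\<And>x. GDERIV f x :> D x" and lip: "L-lipschitz_on UNIV D"
  shows "f (x + h) \<le> f x + D x \<bullet> h + L / 2 * (norm h)\<^sup>2"
proof -
  \<comment> \<open>The claim is \<open>\<phi> 1 \<le> \<phi> 0\<close>; the Lipschitz bound makes
    the derivative of \<open>\<phi>\<close> nonpositive on the unit interval.\<close>
  define \<phi> where "\<phi> t = f (x + t *\<^sub>R h) - t * (D x \<bullet> h) - L / 2 * t\<^sup>2 * (norm h)\<^sup>2" for t
  have "\<phi> 1 \<le> \<phi> 0"
  proof (rule DERIV_nonpos_imp_nonincreasing[of 0 1])
    fix t :: real assume t: "0 \<le> t" "t \<le> 1"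
    have "((\<lambda>t. x + t *\<^sub>R h) has_derivative (\<lambda>r. r *\<^sub>R h)) (at t)"
      by (auto intro!: derivative_eq_intros)
    from has_derivative_compose[OF this, OF D[of "x + t *\<^sub>R h", unfolded gderiv_def]]
    have "((\<lambda>t. f (x + t *\<^sub>R h)) has_derivative (\<lambda>r. r * (D (x + t *\<^sub>R h) \<bullet> h))) (at t)"
      by (simp add: gderiv_def inner_commute)
    then have "((\<lambda>t. f (x + t *\<^sub>R h)) has_field_derivative (D (x + t *\<^sub>R h) \<bullet> h)) (at t)"
      by (simp add: has_field_derivative_def mult_commute_abs)
    then have "(\<phi> has_field_derivative
        (D (x + t *\<^sub>R h) \<bullet> h - D x \<bullet> h - L * t * (norm h)\<^sup>2)) (at t)"
      unfolding \<phi>_def by (auto intro!: derivative_eq_intros)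
    moreover have "D (x + t *\<^sub>R h) \<bullet> h - D x \<bullet> h \<le> L * t * (norm h)\<^sup>2"
    proof -
      have "(D (x + t *\<^sub>R h) - D x) \<bullet> h \<le> norm (D (x + t *\<^sub>R h) - D x) * norm h"
        by (rule norm_cauchy_schwarz)
      also have "norm (D (x + t *\<^sub>R h) - D x) \<le> L * (t * norm h)"
        using lipschitz_onD[OF lip, of "x + t *\<^sub>R h" x] t by (simp add: dist_norm)
      finally show ?thesis
        by (simp add: inner_diff_left power2_eq_square mult_right_mono mult.assoc)
    qed
    ultimately show "\<exists>y. DERIV \<phi> t :> y \<and> y \<le> 0" by force
  qed simp
  then show ?thesis unfolding \<phi>_def by simp
qed

lemma descent_lemma_lower:
  fixes f :: "'a::real_inner \<Rightarrow> real"
  assumes D: "\<And>x. GDERIV f x :> D x" and lip: "L-lipschitz_on UNIV D"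
  shows "f x + D x \<bullet> h - L / 2 * (norm h)\<^sup>2 \<le> f (x + h)"
proof -
  have "GDERIV (\<lambda>x. - f x) x :> - D x" for x
    using GDERIV_minus[OF D] .
  moreover have "L-lipschitz_on UNIV (\<lambda>x. - D x)"
    using lip by (simp add: lipschitz_on_def dist_minus)
  ultimately show ?thesis
    using descent_lemma[of "\<lambda>x. - f x" "\<lambda>x. - D x" L x h] by simp
qed

text \<open>Convexity bounds \<open>f (x + t *\<^sub>R h)\<close> above and
  \<open>descent_lemma_lower\<close> bounds it below; the second-order terms of both add up to the
  factor \<open>(L + \<mu>) / 2\<close>, and \<open>nonneg_first_order\<close> removes them.\<close>

lemma strongly_convex_lower_bound:
  fixes f :: "'a::real_inner \<Rightarrow> real"
  assumes D: "\<And>x. GDERIV f x :> D x" and lip: "L-lipschitz_on UNIV D"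
    and sc: "strongly_convex \<mu> f"
  shows "f x + D x \<bullet> h + \<mu> / 2 * (norm h)\<^sup>2 \<le> f (x + h)"
proof -
  have "0 \<le> t * (f (x + h) - f x - D x \<bullet> h - \<mu> / 2 * (norm h)\<^sup>2)
      + t\<^sup>2 * ((L + \<mu>) / 2 * (norm h)\<^sup>2)" if t: "0 < t" "t \<le> 1" for t
  proof -
    have *: "f ((1 - t) *\<^sub>R x + t *\<^sub>R (x + h)) - \<mu> / 2 * (norm ((1 - t) *\<^sub>R x + t *\<^sub>R (x + h)))\<^sup>2
        \<le> (1 - t) * (f x - \<mu> / 2 * (norm x)\<^sup>2) + t * (f (x + h) - \<mu> / 2 * (norm (x + h))\<^sup>2)"
      using sc t unfolding strongly_convex_def convex_on_def by simp
    have "(1 - t) *\<^sub>R x + t *\<^sub>R (x + h) = x + t *\<^sub>R h"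
      by (simp add: algebra_simps)
    from *[unfolded this]
    have "f (x + t *\<^sub>R h) \<le> (1 - t) * f x + t * f (x + h) - \<mu> / 2 *
        ((1 - t) * (norm x)\<^sup>2 + t * (norm (x + h))\<^sup>2 - (norm (x + t *\<^sub>R h))\<^sup>2)"
      by (simp add: algebra_simps add_divide_distrib diff_divide_distrib)
    also have "(1 - t) * (norm x)\<^sup>2 + t * (norm (x + h))\<^sup>2 - (norm (x + t *\<^sub>R h))\<^sup>2
        = t * (1 - t) * (norm h)\<^sup>2"
      unfolding power2_norm_eq_inner by (simp add: inner_simps inner_commute algebra_simps)
    finally show ?thesis
      using descent_lemma_lower[OF D lip, of x "t *\<^sub>R h"] t
      by (simp add: power_mult_distrib field_simps power2_eq_square)
  qed
  from nonneg_first_order[OF this] show ?thesis by simp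
qed

text \<open>The hypothesis \<open>g\<close> is the variational inequality of the proximal step of
  length \<open>1 / L\<close>. Adding the descent bound at \<open>p\<close> and the strong convexity
  bound at \<open>u\<close> cancels every term with \<open>D x\<close>.\<close>

lemma prox_grad_ineq:
  fixes f :: "'a::real_inner \<Rightarrow> real"
  assumes D: "\<And>x. GDERIV f x :> D x" and lip: "L-lipschitz_on UNIV D"
    and sc: "strongly_convex \<mu> f" and "0 < L"
    and g: "a + L * ((x - (1 / L) *\<^sub>R D x - p) \<bullet> (u - p)) \<le> b"
  shows "f p + a - (f u + b)
    \<le> L * ((x - p) \<bullet> (x - u)) - L / 2 * (norm (x - p))\<^sup>2 - \<mu> / 2 * (norm (x - u))\<^sup>2"
proof -
  have 1: "f p \<le> f x + D x \<bullet> (p - x) + L / 2 * (norm (p - x))\<^sup>2"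
    using descent_lemma[OF D lip, of x "p - x"] by simp
  have 2: "f x + D x \<bullet> (u - x) + \<mu> / 2 * (norm (u - x))\<^sup>2 \<le> f u"
    using strongly_convex_lower_bound[OF D lip sc, of x "u - x"] by simp
  have 3: "L * ((x - (1 / L) *\<^sub>R D x - p) \<bullet> (u - p))
      = L * (norm (x - p))\<^sup>2 - L * ((x - p) \<bullet> (x - u)) - D x \<bullet> (u - x) + D x \<bullet> (p - x)"
    unfolding power2_norm_eq_inner using \<open>0 < L\<close>
    by (simp add: inner_simps inner_commute algebra_simps)
  show ?thesis
    using g 1 2 unfolding 3 norm_minus_commute[of p x] norm_minus_commute[of u x] by argo
qed

section \<open>Energy decay over one iteration\<close>

text \<open>Read \<open>a = x\<^sub>k - y\<^sub>k\<close>, \<open>b = x\<^sub>k - x\<^sup>*\<close>, \<open>d = x\<^sub>k - y\<^sub>k\<^sub>+\<^sub>1\<close>,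
  \<open>w = z\<^sub>k - x\<^sup>*\<close>; the hypotheses are the proximal gradient estimate at \<open>y\<^sub>k\<close> and at \<open>x\<^sup>*\<close>.\<close>

lemma energy_decay:
  fixes a b d w :: "'a::real_inner"
  assumes "0 < \<mu>" "\<mu> \<le> L" "1 \<le> t" "w = (t - 1) *\<^sub>R a + b"
    and h1: "t * (t - 1) * (v' - v)
      \<le> t * (t - 1) * (L * (d \<bullet> a) - L / 2 * (norm d)\<^sup>2 - \<mu> / 2 * (norm a)\<^sup>2)"
    and h2: "v' \<le> L * (d \<bullet> b) - L / 2 * (norm d)\<^sup>2 - \<mu> / 2 * (norm b)\<^sup>2"
  shows "(1 + \<mu> / (3 * L + 5 * \<mu>)) * (t\<^sup>2 * v' + 3 * L / 4 * (norm (w - (2 / 3 * t) *\<^sub>R d))\<^sup>2)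
    \<le> t * (t - 1) * v + 3 * L / 4 * (norm w)\<^sup>2"
proof -
  define P where "P = t\<^sup>2 * (norm d)\<^sup>2"
  define W where "W = (norm w)\<^sup>2"
  define A where "A = t\<^sup>2 * v' + 3 * L / 4 * (norm (w - (2 / 3 * t) *\<^sub>R d))\<^sup>2"
  have nn: "0 \<le> P" "0 \<le> W" unfolding P_def W_def by auto
  \<comment> \<open>\<open>w\<close> is \<open>t\<close> times the convex combination of
    \<open>a\<close> and \<open>b\<close> with weights \<open>(t - 1) / t\<close> and
    \<open>1 / t\<close>.\<close>
  have jensen: "W \<le> t * ((t - 1) * (norm a)\<^sup>2 + (norm b)\<^sup>2)"
  proof -
    have "t * ((t - 1) * (norm a)\<^sup>2 + (norm b)\<^sup>2) - W = (t - 1) * (norm (a - b))\<^sup>2"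
      unfolding W_def assms(4) power2_norm_eq_inner
      by (simp add: inner_simps inner_commute algebra_simps)
    moreover have "0 \<le> (t - 1) * (norm (a - b))\<^sup>2" using \<open>1 \<le> t\<close> by simp
    ultimately show ?thesis by linarith
  qed
  have wd: "(norm (w - (2 / 3 * t) *\<^sub>R d))\<^sup>2 = W - 4 / 3 * t * (d \<bullet> w) + 4 / 9 * P"
    unfolding W_def P_def power2_norm_eq_inner
    by (simp add: inner_simps inner_commute algebra_simps power2_eq_square)
  have dw: "d \<bullet> w = (t - 1) * (d \<bullet> a) + d \<bullet> b"
    unfolding assms(4) by (simp add: inner_simps)
  have "t * v' \<le> t * (L * (d \<bullet> b) - L / 2 * (norm d)\<^sup>2 - \<mu> / 2 * (norm b)\<^sup>2)"
    using h2 \<open>1 \<le> t\<close> by (intro mult_left_mono) auto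
  with h1 have "t\<^sup>2 * v' - t * (t - 1) * v
      \<le> L * t * (d \<bullet> w) - L / 2 * P - \<mu> / 2 * (t * ((t - 1) * (norm a)\<^sup>2 + (norm b)\<^sup>2))"
    unfolding dw P_def by (simp add: field_simps power2_eq_square)
  moreover have "\<mu> / 2 * W \<le> \<mu> / 2 * (t * ((t - 1) * (norm a)\<^sup>2 + (norm b)\<^sup>2))"
    using jensen \<open>0 < \<mu>\<close> by (intro mult_left_mono) auto
  \<comment> \<open>Expanding the norm in \<open>A\<close> cancels
    \<open>L * t * (d \<bullet> w)\<close> and leaves
    \<open>L / 2 - 3 * L / 4 * (4 / 9) = L / 6\<close> as the factor of \<open>P\<close>.\<close>
  ultimately have decrease: "A + L / 6 * P + \<mu> / 2 * W \<le> t * (t - 1) * v + 3 * L / 4 * W"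
    unfolding A_def wd by (simp add: algebra_simps)
  \<comment> \<open>The right side of \<open>h2\<close> is a concave quadratic in \<open>b\<close>,
    maximal at \<open>\<mu> *\<^sub>R b = L *\<^sub>R d\<close>; this bounds \<open>v'\<close> by
    the surplus in \<open>d\<close> alone.\<close>
  have "\<mu> * v' \<le> \<mu> * (L * (d \<bullet> b) - L / 2 * (norm d)\<^sup>2 - \<mu> / 2 * (norm b)\<^sup>2)"
    using h2 \<open>0 < \<mu>\<close> by (intro mult_left_mono) auto
  also have "\<dots> \<le> L * (L - \<mu>) / 2 * (norm d)\<^sup>2"
  proof -
    have "0 \<le> (norm (L *\<^sub>R d - \<mu> *\<^sub>R b))\<^sup>2" by simp
    then show ?thesis
      unfolding power2_norm_eq_inner
      by (simp add: inner_simps inner_commute algebra_simps)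
  qed
  finally have "t\<^sup>2 * (\<mu> * v') \<le> t\<^sup>2 * (L * (L - \<mu>) / 2 * (norm d)\<^sup>2)"
    by (intro mult_left_mono) auto
  then have v': "\<mu> * (t\<^sup>2 * v') \<le> L * (L - \<mu>) / 2 * P"
    unfolding P_def by (simp add: algebra_simps)
  have "(norm (w - (2 / 3 * t) *\<^sub>R d))\<^sup>2 \<le> 2 * W + 8 / 9 * P"
  proof -
    have "0 \<le> (norm (w + (2 / 3 * t) *\<^sub>R d))\<^sup>2" by simp
    also have "\<dots> = W + 4 / 3 * t * (d \<bullet> w) + 4 / 9 * P"
      unfolding W_def P_def power2_norm_eq_inner
      by (simp add: inner_simps inner_commute algebra_simps power2_eq_square)
    finally show ?thesis unfolding wd by simp
  qed
  then have "\<mu> * (3 * L / 4) * (norm (w - (2 / 3 * t) *\<^sub>R d))\<^sup>2 \<le> \<mu> * (3 * L / 4) * (2 * W + 8 / 9 * P)"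
    using assms(1,2) by (intro mult_left_mono) auto
  with v' have "\<mu> * A \<le> L * (L - \<mu>) / 2 * P + \<mu> * (3 * L / 4) * (2 * W + 8 / 9 * P)"
    unfolding A_def distrib_left mult.assoc by linarith
  \<comment> \<open>Comparing coefficients, \<open>P\<close> requires a factor of at least
    \<open>3 * L + \<mu>\<close> and \<open>W\<close> one of at least \<open>3 * L\<close>; the
    factor here leaves the displayed slack.\<close>
  also have "\<dots> \<le> (3 * L + 5 * \<mu>) * (L / 6 * P + \<mu> / 2 * W)"
  proof -
    have "(3 * L + 5 * \<mu>) * (L / 6 * P + \<mu> / 2 * W)
        - (L * (L - \<mu>) / 2 * P + \<mu> * (3 * L / 4) * (2 * W + 8 / 9 * P))
        = 2 / 3 * (L * \<mu>) * P + 5 / 2 * (\<mu> * \<mu>) * W"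
      by (simp add: field_simps)
    moreover have "0 \<le> 2 / 3 * (L * \<mu>) * P + 5 / 2 * (\<mu> * \<mu>) * W"
      using nn assms(1,2) by (intro add_nonneg_nonneg mult_nonneg_nonneg) auto
    ultimately show ?thesis by linarith
  qed
  finally have "\<mu> / (3 * L + 5 * \<mu>) * A \<le> L / 6 * P + \<mu> / 2 * W"
    using assms(1,2) by (simp add: field_simps)
  with decrease show ?thesis
    unfolding A_def[symmetric] W_def[symmetric] by (simp add: algebra_simps)
qed

section \<open>The sequence \<open>t_seq\<close> and the convergence rate\<close>

lemma t_seq_ge_1: "1 \<le> t_seq k"
proof (induction k)
  case (Suc k)
  have "1 \<le> sqrt (1 + 4 * (t_seq k)\<^sup>2)" by simp
  then show ?case by simp
qed simp

text \<open>\<open>t_seq (Suc k)\<close> is the positive root of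
  \<open>r\<^sup>2 - r = (t_seq k)\<^sup>2\<close>. Hence the weight of the next energy is the
  \<open>t\<^sup>2\<close> of \<open>energy_decay\<close>.\<close>

lemma t_seq_Suc: "t_seq (Suc k) * (t_seq (Suc k) - 1) = (t_seq k)\<^sup>2"
proof -
  have "(sqrt (1 + 4 * (t_seq k)\<^sup>2))\<^sup>2 = 1 + 4 * (t_seq k)\<^sup>2" by simp
  then show ?thesis by (simp add: field_simps power2_eq_square)
qed

theorem theorem10:
  fixes f :: "'a::{real_inner, complete_space} \<Rightarrow> real"
    and g F :: "'a \<Rightarrow> ereal"
    and \<mu> L \<rho> :: real
    and x y :: "nat \<Rightarrow> 'a"
    and xstar :: 'a
    and k :: nat
  assumes "0 < \<mu>" and "\<mu> \<le> L"
    and "strongly_convex \<mu> f" and "smooth_with L f"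
    and "convex_ereal g" and "proper_ereal g" and "lower_semicontinuous g"
    and "F = (\<lambda>u. ereal (f u) + g u)"
    and "is_arg_min F (\<lambda>_. True) xstar"
    and "gapm f g (1 / L) (2 / 3) x y"
    and "\<rho> = \<mu> / (3 * L + 5 * \<mu>)"
    and "2 \<le> k"
  shows "F (y k) - F xstar
    \<le> ereal (3 * L * (norm (x 0 - xstar))\<^sup>2 / (4 * t_seq k * (t_seq k - 1))
             * (1 + \<rho>) powi (- int k + 2))"
proof -
  have L: "0 < L" using assms(1,2) by simp
  define D where "D = gradient f"
  have D: "GDERIV f u :> D u" for u
    using assms(4) GDERIV_gradient unfolding smooth_with_def D_def by blast
  have lip: "L-lipschitz_on UNIV D"
    using assms(4) unfolding smooth_with_def D_def by blast
  have F_min: "F xstar \<le> F u" for u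
    using assms(9) unfolding is_arg_min_linorder by simp
  obtain u0 where "g u0 \<noteq> \<infinity>" using assms(6) unfolding proper_ereal_def by blast
  then have "g xstar \<noteq> \<infinity>" using F_min[of u0] unfolding assms(8) by auto
  then obtain gs where gs: "g xstar = ereal gs"
    using assms(6) unfolding proper_ereal_def by (cases "g xstar") auto
  \<comment> \<open>Optimality of \<open>xstar\<close> makes \<open>- D xstar\<close> a subgradient
    of \<open>g\<close> there. The resulting affine minorant keeps the proximal objective bounded
    below.\<close>
  have minorant: "gs - D xstar \<bullet> (u - xstar) \<le> b" if b: "g u = ereal b" for u b
  proof -
    have "0 \<le> t * (b - gs + D xstar \<bullet> (u - xstar)) + t\<^sup>2 * (L / 2 * (norm (u - xstar))\<^sup>2)"
      if t: "0 < t" "t \<le> 1" for t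
    proof -
      define z where "z = xstar + t *\<^sub>R (u - xstar)"
      have gz: "g z \<le> ereal ((1 - t) * gs + t * b)"
        unfolding z_def using convex_ereal_segment[OF assms(5) gs b] t by simp
      have "ereal (f xstar + gs) \<le> ereal (f z) + g z"
        using F_min[of z] gs unfolding assms(8) by simp
      also have "\<dots> \<le> ereal (f z) + ereal ((1 - t) * gs + t * b)"
        by (intro add_left_mono gz)
      finally have "f xstar + gs \<le> f z + ((1 - t) * gs + t * b)" by simp
      moreover have "f z \<le> f xstar + t * (D xstar \<bullet> (u - xstar))
          + t\<^sup>2 * (L / 2 * (norm (u - xstar))\<^sup>2)"
        using descent_lemma[OF D lip, of xstar "t *\<^sub>R (u - xstar)"] unfolding z_def
        by (simp add: power_mult_distrib mult_ac)
      ultimately show ?thesis by (simp add: algebra_simps)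
    qed
    from nonneg_first_order[OF this] show ?thesis by simp
  qed
  have prox_ex: "\<exists>p. is_arg_min (\<lambda>u. g u + ereal (L / 2 * (norm (u - v))\<^sup>2)) (\<lambda>_. True) p" for v
  proof (rule ex_prox_minimizer[OF assms(5-7)])
    show "0 < L / 2" using L by simp
    fix u
    \<comment> \<open>The bound is the minimum over \<open>u\<close> of the affine minorant plus the
      quadratic, found by completing the square in \<open>u - v\<close>.\<close>
    show "ereal (gs - D xstar \<bullet> (v - xstar) - (norm (D xstar))\<^sup>2 / (2 * L))
        \<le> g u + ereal (L / 2 * (norm (u - v))\<^sup>2)"
    proof (cases "g u")
      case (real b)
      have "0 \<le> (norm (D xstar - L *\<^sub>R (u - v)))\<^sup>2 / (2 * L)" using L by simp
      also have "\<dots> = (norm (D xstar))\<^sup>2 / (2 * L) - D xstar \<bullet> (u - v) + L / 2 * (norm (u - v))\<^sup>2"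
      proof -
        have "(norm (D xstar - L *\<^sub>R e))\<^sup>2
            = (norm (D xstar))\<^sup>2 - 2 * L * (D xstar \<bullet> e) + L\<^sup>2 * (norm e)\<^sup>2" for e
          unfolding power2_norm_eq_inner
          by (simp add: inner_simps inner_commute algebra_simps power2_eq_square)
        from this[of "u - v"] show ?thesis
          using L by (simp only:) (simp add: divide_simps power2_eq_square)
      qed
      finally show ?thesis
        using minorant[OF real] real by (simp add: inner_diff_right)
    qed (use assms(6) in \<open>auto simp: proper_ereal_def\<close>)
  qed
  have y_step: "\<exists>a. g (y (Suc n)) = ereal a \<and> (\<forall>u b. g u = ereal b \<longrightarrow>
      f (y (Suc n)) + a - (f u + b) \<le> L * ((x n - y (Suc n)) \<bullet> (x n - u))
        - L / 2 * (norm (x n - y (Suc n)))\<^sup>2 - \<mu> / 2 * (norm (x n - u))\<^sup>2)" for n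
  proof -
    let ?v = "x n - (1 / L) *\<^sub>R D (x n)"
    have "y (Suc n) = prox (1 / L) g ?v"
      using assms(10) unfolding gapm_def D_def by blast
    \<comment> \<open>Since a minimizer exists, the choice in \<open>arg_min\<close> returns one;
      \<open>1 / (2 * s)\<close> is \<open>L / 2\<close> for \<open>s = 1 / L\<close>.\<close>
    then have "is_arg_min (\<lambda>u. g u + ereal (L / 2 * (norm (u - ?v))\<^sup>2)) (\<lambda>_. True) (y (Suc n))"
      using someI_ex[OF prox_ex[of ?v]] unfolding prox_def arg_min_def by simp
    from prox_variational_ineq[OF assms(5,6) this] obtain a where a: "g (y (Suc n)) = ereal a"
      and ineq: "\<And>u b. g u = ereal b \<Longrightarrow>
        a + 2 * (L / 2) * ((?v - y (Suc n)) \<bullet> (u - y (Suc n))) \<le> b"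
      by blast
    then show ?thesis
      using prox_grad_ineq[OF D lip assms(3) L] by fastforce
  qed
  \<comment> \<open>\<open>real_of_ereal\<close> turns an infinite value into 0. Among the iterates
    \<open>y n\<close> this can only affect \<open>y 0\<close>.\<close>
  define G where "G u = real_of_ereal (g u)" for u
  define V where "V n = f (y n) + G (y n) - (f xstar + gs)" for n
  define w where "w n = t_seq n *\<^sub>R x n - (t_seq n - 1) *\<^sub>R y n - xstar" for n
  define E where "E n = t_seq n * (t_seq n - 1) * V n + 3 * L / 4 * (norm (w n))\<^sup>2" for n
  have gy: "g (y (Suc n)) = ereal (G (y (Suc n)))" for n
    using y_step[of n] unfolding G_def by auto
  \<comment> \<open>Multiplying the update by \<open>t_seq (Suc n)\<close> clears its denominators.
    The correction with \<open>\<gamma> - 1\<close> shortens the FISTA step of \<open>w\<close> from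
    \<open>t_seq n\<close> to \<open>2 / 3 * t_seq n\<close>.\<close>
  have w_Suc: "w (Suc n) = w n - (2 / 3 * t_seq n) *\<^sub>R (x n - y (Suc n))" for n
  proof -
    have tS: "t_seq (Suc n) \<noteq> 0" using t_seq_ge_1[of "Suc n"] by linarith
    have xS: "x (Suc n) = y (Suc n) + ((t_seq n - 1) / t_seq (Suc n)) *\<^sub>R (y (Suc n) - y n)
        + (t_seq n / t_seq (Suc n) * (2 / 3 - 1)) *\<^sub>R (y (Suc n) - x n)"
      using assms(10) unfolding gapm_def by blast
    have "t_seq (Suc n) *\<^sub>R x (Suc n) = t_seq (Suc n) *\<^sub>R y (Suc n)
        + (t_seq n - 1) *\<^sub>R (y (Suc n) - y n) + (t_seq n * (2 / 3 - 1)) *\<^sub>R (y (Suc n) - x n)"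
      unfolding xS scaleR_add_right scaleR_scaleR using tS by (simp del: t_seq.simps)
    then have "w (Suc n) = y (Suc n) + (t_seq n - 1) *\<^sub>R (y (Suc n) - y n)
        + (t_seq n * (2 / 3 - 1)) *\<^sub>R (y (Suc n) - x n) - xstar"
      unfolding w_def by (simp add: algebra_simps del: t_seq.simps)
    also have "\<dots> = w n - (2 / 3 * t_seq n) *\<^sub>R (x n - y (Suc n))"
    proof -
      have "(t_seq n * (2 / 3 - 1)) *\<^sub>R (y (Suc n) - x n)
          = (t_seq n - 2 / 3 * t_seq n) *\<^sub>R (x n - y (Suc n))"
        by (simp add: algebra_simps)
      then show ?thesis
        unfolding w_def scaleR_diff_left by (simp add: scaleR_diff_right)
    qed
    finally show ?thesis .
  qed
  have decay: "(1 + \<rho>) * E (Suc n) \<le> E n" for n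
  proof -
    have ineq: "f (y (Suc n)) + G (y (Suc n)) - (f u + b) \<le> L * ((x n - y (Suc n)) \<bullet> (x n - u))
        - L / 2 * (norm (x n - y (Suc n)))\<^sup>2 - \<mu> / 2 * (norm (x n - u))\<^sup>2"
      if "g u = ereal b" for u b
      using y_step[of n] that unfolding gy by auto
    have 1: "t_seq n * (t_seq n - 1) * (V (Suc n) - V n)
        \<le> t_seq n * (t_seq n - 1) * (L * ((x n - y (Suc n)) \<bullet> (x n - y n))
          - L / 2 * (norm (x n - y (Suc n)))\<^sup>2 - \<mu> / 2 * (norm (x n - y n))\<^sup>2)"
    proof (cases n)
      case 0
      \<comment> \<open>\<open>F (y 0)\<close> may be infinite, but its weight vanishes since \<open>t_seq 0 = 1\<close>.\<close>
      then show ?thesis by simp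
    next
      case (Suc m)
      show ?thesis
        using ineq[OF gy[of m]] t_seq_ge_1[of n] unfolding V_def Suc
        by (intro mult_left_mono) auto
    qed
    have 2: "V (Suc n) \<le> L * ((x n - y (Suc n)) \<bullet> (x n - xstar))
        - L / 2 * (norm (x n - y (Suc n)))\<^sup>2 - \<mu> / 2 * (norm (x n - xstar))\<^sup>2"
      using ineq[OF gs] unfolding V_def .
    have w: "w n = (t_seq n - 1) *\<^sub>R (x n - y n) + (x n - xstar)"
      unfolding w_def by (simp add: algebra_simps)
    show ?thesis
      using energy_decay[OF assms(1,2) t_seq_ge_1 w 1 2]
      unfolding E_def t_seq_Suc w_Suc assms(11) .
  qed
  have \<rho>: "0 \<le> \<rho>" unfolding assms(11) using assms(1,2) by simp
  have "(1 + \<rho>) ^ n * E n \<le> E 0" for n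
  proof (induction n)
    case (Suc n)
    have "(1 + \<rho>) ^ n * ((1 + \<rho>) * E (Suc n)) \<le> (1 + \<rho>) ^ n * E n"
      using decay \<rho> by (intro mult_left_mono) auto
    with Suc show ?case by (simp add: mult_ac)
  qed simp
  \<comment> \<open>As \<open>t_seq 0 = 1\<close>, the function values drop out of
    \<open>E 0\<close> and \<open>w 0 = x 0 - xstar\<close>.\<close>
  then have Ek: "(1 + \<rho>) ^ k * E k \<le> 3 * L / 4 * (norm (x 0 - xstar))\<^sup>2"
    unfolding E_def[of 0] w_def[of 0] by simp
  \<comment> \<open>As a successor, \<open>k\<close> has \<open>T = (t_seq m)\<^sup>2 > 0\<close>,
    and \<open>y k\<close> is a proximal point, where \<open>g\<close> is finite.\<close>
  obtain m where m: "k = Suc m" using assms(12) by (cases k) auto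
  define T where "T = t_seq k * (t_seq k - 1)"
  have T: "0 < T"
    using t_seq_ge_1[of m] unfolding T_def m t_seq_Suc by simp
  define R where "R = 3 * L / 4 * (norm (x 0 - xstar))\<^sup>2"
  have R: "0 \<le> R" unfolding R_def using L by simp
  have FV: "F (y k) - F xstar = ereal (V k)"
    unfolding assms(8) gs m gy V_def by simp
  have "T * V k \<le> E k" unfolding E_def T_def using L by simp
  then have "(1 + \<rho>) ^ k * (T * V k) \<le> (1 + \<rho>) ^ k * E k"
    using \<rho> by (intro mult_left_mono) auto
  also have "\<dots> \<le> R" using Ek unfolding R_def .
  finally have "V k \<le> R / T * inverse ((1 + \<rho>) ^ k)"
    using T \<rho> by (simp add: field_simps)
  also have "inverse ((1 + \<rho>) ^ k) = (1 + \<rho>) powi (- int k)"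
    by (simp add: power_int_minus)
  \<comment> \<open>The energy yields the exponent \<open>- int k\<close>; since
    \<open>1 + \<rho> \<ge> 1\<close>, raising it by 2 only enlarges the bound.\<close>
  also have "R / T * (1 + \<rho>) powi (- int k) \<le> R / T * (1 + \<rho>) powi (- int k + 2)"
    using R T \<rho> by (intro mult_left_mono power_int_increasing) auto
  also have "R / T = 3 * L * (norm (x 0 - xstar))\<^sup>2 / (4 * t_seq k * (t_seq k - 1))"
    unfolding R_def T_def by simp
  finally show ?thesis unfolding FV ereal_less_eq(3) .
qed

end
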